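(* Let $X$ and $Y$ be Tychonoff spaces, let $A$ be a closed, Lindelöf and Čech-complete subspace of $X$ that is also $C$-embedded in $X$, and let $f:Y\to X$ be a perfect surjection. Then $f^{-1}[A]$ is $C$-embedded in $Y$.
   Context: A subspace $A$ of a space $X$ is $C$-embedded in $X$ if every continuous function from $A$ to $\mathbb{R}$ admits a continuous extension to $X$. A Tychonoff space is Čech-complete if it is a $G_\delta$-subset of (some, equivalently every) Hausdorff compactification of it. A map is perfect if it is continuous, closed, and all of its fibers are compact. *)

theory Defs
  imports "HOL-Analysis.Analysis"
begin

definition Tychonoff_space :: "'a topology \<Rightarrow> bool" where
  "Tychonoff_space X \<longleftrightarrow> completely_regular_space X \<and> Hausdorff_space X"

definition Hausdorff_compactification :: "'a topology \<Rightarrow> 'k topology \<Rightarrow> ('a \<Rightarrow> 'k) \<Rightarrow> bool" where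
  "Hausdorff_compactification X K e \<longleftrightarrow>
     compact_space K \<and> Hausdorff_space K \<and> embedding_map X K e \<and>
     K closure_of (e ` topspace X) = topspace K"

text \<open>
  A definition cannot quantify over the carrier type of the compactification. The type
  \<open>'a set set\<close> loses nothing: a point of a Hausdorff compactification \<open>K\<close> of \<open>X\<close> is determined by
  the traces on \<open>X\<close> of its open neighbourhoods, so \<open>K\<close> is homeomorphic to a compactification of
  \<open>X\<close> carried by a set of elements of \<open>'a set set\<close>. The lemma
  \<open>Cech_complete_space_if_compactification\<close> below confirms this.
\<close>

definition Cech_complete_space :: "'a topology \<Rightarrow> bool" where
  "Cech_complete_space X \<longleftrightarrow>
     Tychonoff_space X \<and>
     (\<exists>(K :: 'a set set topology) e.
        Hausdorff_compactification X K e \<and> gdelta_in K (e ` topspace X))"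

definition C_embedded_in :: "'a topology \<Rightarrow> 'a set \<Rightarrow> bool" where
  "C_embedded_in X A \<longleftrightarrow>
     A \<subseteq> topspace X \<and>
     (\<forall>f. continuous_map (subtopology X A) euclideanreal f \<longrightarrow>
        (\<exists>g. continuous_map X euclideanreal g \<and> (\<forall>x\<in>A. g x = f x)))"

lemma homeomorphic_copy:
  assumes "inj_on j (topspace K)"
  obtains K' where "homeomorphic_map K K' j"
proof
  let ?i = "inv_into (topspace K) j"
  let ?K = "pullback_topology (j ` topspace K) ?i K"
  have i: "?i (j x) = x" if "x \<in> topspace K" for x
    using assms that by simp
  have ts: "topspace ?K = j ` topspace K"
    by (auto simp: topspace_pullback_topology i)
  have "homeomorphic_maps K ?K j ?i"
    unfolding homeomorphic_maps_def
  proof (intro conjI)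
    show "continuous_map K ?K j"
    proof (rule continuous_map_pullback')
      show "continuous_map K K (?i \<circ> j)"
        by (rule continuous_map_eq[OF continuous_map_id]) (simp add: i)
      show "topspace K \<subseteq> j -` j ` topspace K"
        by auto
    qed
    show "continuous_map ?K K ?i"
      using continuous_map_pullback[OF continuous_map_id, of "j ` topspace K" ?i K] by simp
  qed (auto simp: ts i)
  then show "homeomorphic_map K ?K j"
    using homeomorphic_map_maps by blast
qed

lemma Cech_complete_space_if_compactification:
  fixes X :: "'a topology" and K :: "'k topology"
  assumes X: "Tychonoff_space X" and K: "Hausdorff_compactification X K e"
    and G: "gdelta_in K (e ` topspace X)"
  shows "Cech_complete_space X"
proof -
  have cK: "compact_space K" and hK: "Hausdorff_space K" and emb: "embedding_map X K e"
    and dense: "K closure_of (e ` topspace X) = topspace K"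
    using K by (auto simp: Hausdorff_compactification_def)
  define j where "j k = {{x \<in> topspace X. e x \<in> U} | U. openin K U \<and> k \<in> U}" for k
  have "inj_on j (topspace K)"
  proof (rule inj_onI, rule ccontr)
    fix k l assume kl: "k \<in> topspace K" "l \<in> topspace K" "j k = j l" "k \<noteq> l"
    then obtain U V where UV: "openin K U" "openin K V" "k \<in> U" "l \<in> V" "disjnt U V"
      using hK unfolding Hausdorff_space_def by metis
    have "{x \<in> topspace X. e x \<in> U} \<in> j l"
      using UV kl(3)[symmetric] unfolding j_def by blast
    then obtain W where W: "openin K W" "l \<in> W"
      "{x \<in> topspace X. e x \<in> U} = {x \<in> topspace X. e x \<in> W}"
      unfolding j_def by auto
    have "openin K (W \<inter> V)" "l \<in> W \<inter> V" "l \<in> K closure_of (e ` topspace X)"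
      using W UV kl dense by auto
    then obtain x where "x \<in> topspace X" "e x \<in> W" "e x \<in> V"
      unfolding in_closure_of by blast
    then show False
      using W(3) UV(5) by (auto simp: disjnt_iff)
  qed
  then obtain K' where K': "homeomorphic_map K K' j"
    by (rule homeomorphic_copy)
  have sub: "e ` topspace X \<subseteq> topspace K"
    using G gdelta_in_subset by blast
  have hs: "K homeomorphic_space K'"
    using K' homeomorphic_map_imp_homeomorphic_space by blast
  have "compact_space K'"
    using hs cK homeomorphic_compact_space by blast
  moreover have "Hausdorff_space K'"
    using hs hK homeomorphic_Hausdorff_space by blast
  moreover have "embedding_map X K' (j \<circ> e)"
    using emb K' embedding_map_compose
    by (metis embedding_map_def homeomorphic_imp_surjective_map subtopology_topspace)
  moreover have "K' closure_of ((j \<circ> e) ` topspace X) = topspace K'"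
    using homeomorphic_map_closure_of[OF K' sub] dense homeomorphic_imp_surjective_map[OF K']
    by (simp add: image_comp)
  moreover have "gdelta_in K' ((j \<circ> e) ` topspace X)"
    using homeomorphic_map_gdeltaness[OF K' sub] G by (simp add: image_comp)
  ultimately show ?thesis
    using X unfolding Cech_complete_space_def Hausdorff_compactification_def by blast
qed

end

theory Submission
  imports Defs
begin

text \<open>
  Write \<open>\<real>\<^sup>\<omega>\<close> for the type \<open>nat \<Rightarrow> real\<close> with its product topology, and \<open>B\<close> for the preimage of
  \<open>A\<close> under \<open>f\<close>. The theorem rests on two facts.

  First, a Lindelof Cech-complete space has a proper continuous map \<open>p\<close> into \<open>\<real>\<^sup>\<omega>\<close>
  (\<open>Lindelof_Cech_complete_proper_map\<close>). In a compactification the space is an intersection of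
  open sets \<open>C n\<close>. The Lindelof property yields, for each \<open>n\<close>, a continuous function \<open>\<phi> n\<close> on the
  compactification that is positive on the space and zero outside \<open>C n\<close>. The reciprocals of the
  \<open>\<phi> n\<close> are the coordinates of \<open>p\<close>: if all of them stay bounded, the points stay
  inside a compact subset of every \<open>C n\<close>, hence inside a compact part of the space.

  Secondly, if the restriction to \<open>B\<close> of a continuous map \<open>h\<close> from a Tychonoff space \<open>Y\<close> to a
  regular Lindelof space \<open>Z\<close> is proper, then \<open>B\<close> is C-embedded in \<open>Y\<close>
  (\<open>C_embedded_in_if_proper_map_extends\<close>). Indeed, pairing \<open>h\<close> with an embedding of \<open>Y\<close> in a cube
  places \<open>B\<close> as a closed subspace in the product of the cube and \<open>Z\<close>. This product is regular and
  Lindelof, so it is normal, and the Tietze theorem extends real functions from \<open>B\<close> to the product.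

  The two combine because \<open>A\<close> is C-embedded in \<open>X\<close>: each coordinate of the proper map \<open>p\<close> on \<open>A\<close>
  extends to \<open>X\<close>. The composite of the extended map with \<open>f\<close> is a continuous map from \<open>Y\<close> to
  \<open>\<real>\<^sup>\<omega>\<close>. On \<open>B\<close> it is the composite of \<open>p\<close> with the restriction of \<open>f\<close>, and both are proper.
\<close>

lemma Lindelof_space_prod_compact:
  assumes "compact_space X" and "Lindelof_space Y"
  shows "Lindelof_space (prod_topology X Y)"
proof (rule Lindelof_space_proper_map_preimage)
  show "proper_map (prod_topology X Y) Y snd"
    unfolding proper_map_def
  proof (intro conjI ballI)
    show "closed_map (prod_topology X Y) Y snd"
      using assms closed_map_snd by blast
    fix y assume "y \<in> topspace Y"
    then have "{z \<in> topspace (prod_topology X Y). snd z = y} = topspace X \<times> {y}"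
      by auto
    then show "compactin (prod_topology X Y) {z \<in> topspace (prod_topology X Y). snd z = y}"
      using assms \<open>y \<in> topspace Y\<close> by (simp add: compactin_Times compact_space_def)
  qed
qed (fact assms)

text \<open>
  Properness of \<open>h\<close> on \<open>B\<close> makes the image of \<open>B\<close> closed in the product of a cube and \<open>Z\<close>, since
  pairing a proper map with any continuous map into a Hausdorff space is again proper. The cube
  coordinate makes this pairing injective, while the factor \<open>Z\<close> is what makes it closed, since \<open>B\<close>
  may be far from closed in the cube. Compactness of the cube keeps the product Lindelof, and so
  normal.
\<close>

lemma C_embedded_in_if_proper_map_extends:
  fixes Y :: "'b topology" and Z :: "'c topology"
  assumes Y: "Tychonoff_space Y" and Z: "regular_space Z" "Lindelof_space Z"
    and B: "B \<subseteq> topspace Y"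
    and h: "continuous_map Y Z h" and h_proper: "proper_map (subtopology Y B) Z h"
  shows "C_embedded_in Y B"
  unfolding C_embedded_in_def
proof (intro conjI allI impI)
  fix g :: "'b \<Rightarrow> real"
  assume g: "continuous_map (subtopology Y B) euclideanreal g"
  obtain I :: "('b \<Rightarrow> real) set" and e
    where e0: "embedding_map Y (product_topology (\<lambda>u. top_of_set {0..1::real}) I) e"
    using Y completely_regular_space_cube_embedding unfolding Tychonoff_space_def by blast
  define cube where "cube = product_topology (\<lambda>u. top_of_set {0..1::real}) I"
  have e: "embedding_map Y cube e"
    using e0 by (simp add: cube_def)
  then have conte: "continuous_map Y cube e" and inje: "inj_on e (topspace Y)"
    by (simp_all add: embedding_map_def homeomorphic_eq_everything_map continuous_map_in_subtopology)
  have compact: "compact_space cube"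
    unfolding cube_def
    using compact_space_product_topology compact_space_subtopology compactin_euclidean_iff by blast
  have hausdorff: "Hausdorff_space cube"
    unfolding cube_def
    using Hausdorff_space_euclidean Hausdorff_space_product_topology Hausdorff_space_subtopology
    by blast
  let ?P = "prod_topology cube Z" and ?d = "\<lambda>y. (e y, h y)"
  have "regular_space ?P"
    using compact_Hausdorff_imp_regular_space[OF compact hausdorff] Z
    by (simp add: regular_space_prod_topology)
  then have normal: "normal_space ?P"
    using Lindelof_space_prod_compact[OF compact Z(2)] regular_Lindelof_imp_normal_space by blast
  have contd: "continuous_map Y ?P ?d"
    using conte h by (simp add: continuous_map_paired)
  have "proper_map (subtopology Y B) ?P ?d"
    using hausdorff conte h_proper by (intro proper_map_paired) (auto intro: continuous_map_from_subtopology)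
  then have closed: "closed_map (subtopology Y B) ?P ?d"
    by (rule proper_imp_closed_map)
  have "embedding_map (subtopology Y B) ?P ?d"
  proof (rule injective_closed_imp_embedding_map[OF _ closed])
    show "inj_on ?d (topspace (subtopology Y B))"
      using inje by (auto simp: inj_on_def)
  qed (use contd continuous_map_from_subtopology in blast)
  then obtain r where r: "homeomorphic_maps (subtopology Y B) (subtopology ?P (?d ` B)) ?d r"
    using B by (auto simp: embedding_map_def homeomorphic_map_maps Int_absorb1)
  have clo: "closedin ?P (?d ` B)"
    using closed B closedin_topspace[of "subtopology Y B"] unfolding closed_map_def
    by (simp add: Int_absorb1)
  have "continuous_map (subtopology ?P (?d ` B)) euclideanreal (g \<circ> r)"
    using r g unfolding homeomorphic_maps_def by (blast intro: continuous_map_compose)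
  then obtain G where G: "continuous_map ?P euclideanreal G"
      "\<And>z. z \<in> ?d ` B \<Longrightarrow> G z = (g \<circ> r) z"
    by (rule Tietze_extension_realinterval[OF normal clo is_interval_univ UNIV_not_empty]) auto
  have "G (?d y) = g y" if "y \<in> B" for y
    using G(2)[of "?d y"] r that B by (auto simp: homeomorphic_maps_def)
  then show "\<exists>k. continuous_map Y euclideanreal k \<and> (\<forall>y\<in>B. k y = g y)"
    using continuous_map_compose[OF contd G(1)] by (intro exI[of _ "G \<circ> ?d"]) auto
qed (fact B)

text \<open>
  Complete regularity separates each point of \<open>S\<close> from the complement of \<open>U\<close>, and countably many
  of these functions suffice. The usual weighted sum of countably many functions is replaced by the
  distance of the sequence of their values to the zero sequence: any metric that induces the
  product topology has the needed properties, and continuity can be checked coordinatewise.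
\<close>

lemma Lindelof_in_open_cozero:
  fixes K :: "'k topology"
  assumes K: "completely_regular_space K" and S: "Lindelof_space (subtopology K S)"
    and U: "openin K U" "S \<subseteq> U"
  obtains \<phi> :: "'k \<Rightarrow> real" where "continuous_map K euclideanreal \<phi>"
    "\<And>x. x \<in> S \<Longrightarrow> \<phi> x > 0" "\<And>x. x \<in> topspace K - U \<Longrightarrow> \<phi> x = 0"
proof -
  define \<C> where "\<C> = {u :: 'k \<Rightarrow> real. continuous_map K euclideanreal u \<and> (\<forall>x \<in> topspace K - U. u x = 0)}"
  define coz where "coz u = {x \<in> topspace K. u x \<noteq> 0}" for u :: "'k \<Rightarrow> real"
  have SK: "S \<subseteq> topspace K"
    using U openin_subset by blast
  have op: "openin K (coz u)" if "u \<in> \<C>" for u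
    using that openin_continuous_map_preimage[of K euclideanreal u "- {0}"]
    by (auto simp: \<C>_def coz_def)
  have cover: "S \<subseteq> \<Union> (coz ` \<C>)"
  proof
    fix x assume "x \<in> S"
    then obtain v where v: "continuous_map K euclideanreal v" "v x = 0"
        "v ` (topspace K - U) \<subseteq> {1}"
      using K[unfolded completely_regular_space_alt', rule_format, OF U(1), of x] U(2) by auto
    then have "continuous_map K euclideanreal (\<lambda>y. 1 - v y)"
      by (intro continuous_map_diff) auto
    then have "(\<lambda>y. 1 - v y) \<in> \<C>"
      using v(3) by (auto simp: \<C>_def)
    moreover have "x \<in> coz (\<lambda>y. 1 - v y)"
      using v \<open>x \<in> S\<close> SK by (auto simp: coz_def)
    ultimately show "x \<in> \<Union> (coz ` \<C>)"
      by blast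
  qed
  have "\<exists>\<V>. countable \<V> \<and> \<V> \<subseteq> coz ` \<C> \<and> S \<subseteq> \<Union>\<V>"
    using S SK cover op by (auto simp: Lindelof_space_subtopology_subset)
  then obtain \<D> where \<D>: "countable \<D>" "\<D> \<subseteq> \<C>" "S \<subseteq> \<Union> (coz ` \<D>)"
    by (metis countable_subset_image)
  have zero: "(\<lambda>_. 0) \<in> \<C>"
    by (simp add: \<C>_def)
  \<comment> \<open>Adding the zero function makes the family nonempty, so that a sequence enumerates it.\<close>
  define w where "w = from_nat_into (insert (\<lambda>_. 0) \<D>)"
  have rw: "range w = insert (\<lambda>_. 0) \<D>"
    unfolding w_def using \<D> by (intro range_from_nat_into) auto
  then have wC: "w n \<in> \<C>" for n
    using \<D> zero by (metis insert_subset rangeI subsetD)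
  define \<phi> where "\<phi> = (\<lambda>x. dist (\<lambda>n. w n x) (\<lambda>_. 0))"
  show thesis
  proof
    have "continuous_map K euclidean (\<lambda>x n. w n x)"
      using wC unfolding euclidean_product_topology[symmetric]
      by (auto simp: continuous_map_componentwise_UNIV \<C>_def)
    moreover have "continuous_map euclidean euclideanreal (\<lambda>t. dist t (\<lambda>_::nat. 0::real))"
      by (auto intro!: continuous_intros)
    ultimately have "continuous_map K euclideanreal ((\<lambda>t. dist t (\<lambda>_. 0)) \<circ> (\<lambda>x n. w n x))"
      by (rule continuous_map_compose)
    then show "continuous_map K euclideanreal \<phi>"
      by (simp add: \<phi>_def comp_def)
    show "\<phi> x > 0" if "x \<in> S" for x
    proof -
      obtain u where "u \<in> \<D>" "u x \<noteq> 0"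
        using \<D> \<open>x \<in> S\<close> by (auto simp: coz_def)
      then obtain n where "w n x \<noteq> 0"
        using rw by (metis insertI2 rangeE)
      then show ?thesis
        unfolding \<phi>_def zero_less_dist_iff by metis
    qed
    show "\<phi> x = 0" if "x \<in> topspace K - U" for x
      using wC that by (simp add: \<phi>_def \<C>_def)
  qed
qed

text \<open>
  The \<open>n\<close>-th coordinate of \<open>q\<close> is the reciprocal of a function that vanishes outside the \<open>n\<close>-th open
  set, so it tends to infinity wherever a point of \<open>S\<close> approaches the complement of that set.
  As the target is metrizable, hence a k-space, it is enough for properness that preimages of
  compact sets are compact.
\<close>

lemma Lindelof_gdelta_proper_map:
  fixes K :: "'k topology"
  assumes K: "compact_space K" "Hausdorff_space K"
    and S: "gdelta_in K S" "Lindelof_space (subtopology K S)"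
  obtains q :: "'k \<Rightarrow> nat \<Rightarrow> real"
  where "continuous_map (subtopology K S) euclidean q" "proper_map (subtopology K S) euclidean q"
proof -
  have creg: "completely_regular_space K"
    using K by (metis compact_Hausdorff_or_regular_imp_normal_space normal_imp_completely_regular_space)
  have SK: "S \<subseteq> topspace K"
    using S gdelta_in_subset by blast
  obtain C where C: "\<And>n::nat. openin K (C n)" "\<Inter> (range C) = S"
    using S unfolding gdelta_in_descending by blast
  have "\<exists>\<phi>. continuous_map K euclideanreal \<phi> \<and> (\<forall>x\<in>S. \<phi> x > 0) \<and> (\<forall>x\<in>topspace K - C n. \<phi> x = 0)" for n
    by (rule Lindelof_in_open_cozero[OF creg S(2), of "C n"]) (use C in auto)
  then obtain \<phi> where \<phi>: "\<And>n. continuous_map K euclideanreal (\<phi> n)" "\<And>n x. x \<in> S \<Longrightarrow> \<phi> n x > 0"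
      "\<And>n x. x \<in> topspace K - C n \<Longrightarrow> \<phi> n x = 0"
    by metis
  define q where "q x = (\<lambda>n. inverse (\<phi> n x))" for x
  have contq: "continuous_map (subtopology K S) euclidean q"
    unfolding q_def euclidean_product_topology[symmetric] continuous_map_componentwise_UNIV
  proof
    fix n
    have "continuous_map (subtopology K S) euclideanreal (\<phi> n)"
      using \<phi>(1) continuous_map_from_subtopology by blast
    moreover have "\<phi> n x \<noteq> 0" if "x \<in> S" for x
      using \<phi>(2)[OF that, of n] by simp
    ultimately show "continuous_map (subtopology K S) euclideanreal (\<lambda>x. inverse (\<phi> n x))"
      by (intro continuous_map_real_inverse) auto
  qed
  have "proper_map (subtopology K S) euclidean q"
  proof (rule compact_imp_proper_map)
    show "k_space (euclidean :: (nat \<Rightarrow> real) topology)"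
      by (rule k_space_euclideanreal)
    show "kc_space (euclidean :: (nat \<Rightarrow> real) topology)"
      by (simp add: Hausdorff_imp_kc_space)
    fix T :: "(nat \<Rightarrow> real) set"
    assume T: "compactin euclidean T"
    have "\<exists>c>0. \<forall>t\<in>T. t n \<le> c" for n
    proof -
      have "compact ((\<lambda>t. t n) ` T)"
        using T continuous_on_subset[OF continuous_on_product_coordinates subset_UNIV]
      by (intro compact_continuous_image) auto
      then show ?thesis
        using bounded_pos[of "(\<lambda>t. t n) ` T"] compact_imp_bounded by fastforce
    qed
    then obtain c where c: "\<And>n. c n > 0" "\<And>n t. t \<in> T \<Longrightarrow> t n \<le> c n"
      by metis
    \<comment> \<open>The coordinates of \<open>q\<close> are bounded by \<open>c\<close> exactly on this set, which is closed in all of \<open>K\<close>.\<close>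
    let ?L = "{x \<in> topspace K. \<forall>n. \<phi> n x \<ge> inverse (c n)}"
    have "closedin K {x \<in> topspace K. \<phi> n x \<ge> inverse (c n)}" for n
      using closedin_continuous_map_preimage[OF \<phi>(1)[of n], of "{inverse (c n)..}"] by simp
    moreover have "?L = (\<Inter>n. {x \<in> topspace K. \<phi> n x \<ge> inverse (c n)})"
      by auto
    ultimately have "closedin K ?L"
      by auto
    then have "compactin K ?L"
      using K closedin_compact_space by blast
    moreover have "?L \<subseteq> S"
    proof
      fix x assume x: "x \<in> ?L"
      have "x \<in> C n" for n
      proof (rule ccontr)
        assume "x \<notin> C n"
        then have "\<phi> n x = 0"
          using x \<phi>(3) by blast
        then show False
          using x c(1)[of n] by (metis (mono_tags, lifting) inverse_positive_iff_positive mem_Collect_eq not_le)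
      qed
      then show "x \<in> S"
        using C by blast
    qed
    ultimately have L: "compactin (subtopology K S) ?L"
      by (simp add: compactin_subtopology)
    show "compactin (subtopology K S) {x \<in> topspace (subtopology K S). q x \<in> T}"
    proof (rule closed_compactin[OF L])
      show "{x \<in> topspace (subtopology K S). q x \<in> T} \<subseteq> ?L"
      proof clarsimp
        fix x n assume "x \<in> S" "q x \<in> T"
        then have "inverse (\<phi> n x) \<le> c n" "\<phi> n x > 0"
          using c(2) \<phi>(2) by (auto simp: q_def)
        then show "inverse (c n) \<le> \<phi> n x"
          by (metis inverse_inverse_eq inverse_positive_iff_positive le_imp_inverse_le)
      qed
      have "closed T"
        using T compact_imp_closed by auto
      then show "closedin (subtopology K S) {x \<in> topspace (subtopology K S). q x \<in> T}"
        using closedin_continuous_map_preimage[OF contq] by (simp add: Collect_conj_eq)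
    qed
  qed (use contq in auto)
  with contq show thesis
    by (rule that)
qed

text \<open>
  This is one half of Frolik's characterization of the Lindelof Cech-complete spaces as the perfect
  preimages of Polish spaces: the image of a proper map is closed in \<open>\<real>\<^sup>\<omega>\<close>, hence Polish.
\<close>

lemma Lindelof_Cech_complete_proper_map:
  fixes X :: "'a topology"
  assumes L: "Lindelof_space X" and C: "Cech_complete_space X"
  obtains p :: "'a \<Rightarrow> nat \<Rightarrow> real" where "continuous_map X euclidean p" "proper_map X euclidean p"
proof -
  obtain K :: "'a set set topology" and e where Ke: "compact_space K" "Hausdorff_space K"
      "embedding_map X K e" and G: "gdelta_in K (e ` topspace X)"
    using C unfolding Cech_complete_space_def Hausdorff_compactification_def by blast
  have hom: "homeomorphic_map X (subtopology K (e ` topspace X)) e"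
    using Ke by (simp add: embedding_map_def)
  then have "Lindelof_space (subtopology K (e ` topspace X))"
    using L Lindelof_space_quotient_map_image homeomorphic_map_def by blast
  then obtain q :: "'a set set \<Rightarrow> nat \<Rightarrow> real"
    where "continuous_map (subtopology K (e ` topspace X)) euclidean q"
      "proper_map (subtopology K (e ` topspace X)) euclidean q"
    using Lindelof_gdelta_proper_map[OF Ke(1,2) G] by blast
  then show thesis
    using hom by (intro that[of "q \<circ> e"])
      (auto intro: continuous_map_compose proper_map_compose homeomorphic_imp_continuous_map
        homeomorphic_imp_proper_map)
qed

theorem theorem2p7:
  fixes X :: "'a topology" and Y :: "'b topology" and A :: "'a set" and f :: "'b \<Rightarrow> 'a"
  assumes "Tychonoff_space X"
    and "Tychonoff_space Y"
    and "closedin X A"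
    and "Lindelof_space (subtopology X A)"
    and "Cech_complete_space (subtopology X A)"
    and "C_embedded_in X A"
    and "perfect_map Y X f"
  shows "C_embedded_in Y {y \<in> topspace Y. f y \<in> A}"
proof -
  let ?B = "{y \<in> topspace Y. f y \<in> A}"
  obtain p :: "'a \<Rightarrow> nat \<Rightarrow> real" where p: "continuous_map (subtopology X A) euclidean p"
      "proper_map (subtopology X A) euclidean p"
    using Lindelof_Cech_complete_proper_map assms by blast
  have "continuous_map (subtopology X A) euclideanreal (\<lambda>x. p x n)" for n
    using p(1) unfolding euclidean_product_topology[symmetric] continuous_map_componentwise_UNIV
    by blast
  then have "\<exists>k. continuous_map X euclideanreal k \<and> (\<forall>x\<in>A. k x = p x n)" for n
    using assms(6) unfolding C_embedded_in_def by blast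
  then obtain k where k: "\<And>n. continuous_map X euclideanreal (k n)" "\<And>n x. x \<in> A \<Longrightarrow> k n x = p x n"
    by metis
  let ?P = "\<lambda>x n. k n x"
  have contP: "continuous_map X euclidean ?P"
    unfolding euclidean_product_topology[symmetric] continuous_map_componentwise_UNIV
    using k(1) by blast
  show ?thesis
  proof (rule C_embedded_in_if_proper_map_extends[OF assms(2)])
    show "regular_space (euclidean :: (nat \<Rightarrow> real) topology)"
      by (simp add: metrizable_imp_regular_space metrizable_space_euclidean)
    show "Lindelof_space (euclidean :: (nat \<Rightarrow> real) topology)"
      unfolding Lindelof_space_def by (metis Lindelof open_openin topspace_euclidean)
    show "continuous_map Y euclidean (?P \<circ> f)"
      using assms(7) contP unfolding perfect_map_def by (blast intro: continuous_map_compose)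
    have "proper_map (subtopology Y ?B) (subtopology X A) f"
      using assms(7) by (intro proper_map_restriction) (auto simp: perfect_map_def)
    then have "proper_map (subtopology Y ?B) euclidean (p \<circ> f)"
      using p(2) by (rule proper_map_compose)
    moreover have "(?P \<circ> f) y = (p \<circ> f) y" if "y \<in> ?B" for y
      using that k(2) by auto
    ultimately show "proper_map (subtopology Y ?B) euclidean (?P \<circ> f)"
      unfolding proper_map_def
      by (auto elim!: closed_map_eq cong: conj_cong)
  qed auto
qed

end
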